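(* Let $g\in\mathcal{D}$ and suppose that the Volterra operator $\mathbf{T}_g$ acts boundedly on $\mathcal{H}^2$. Then the Hankel form $\mathbf{H}_g$ is bounded.
   Context: $\mathcal{D}$ is the class of functions expressible as a Dirichlet series in some half-plane $\{s:\mathrm{Re}\,s>\theta\}$. $\mathcal{H}^2$ is the Hilbert space of Dirichlet series $f(s)=\sum_{n\ge1}a_nn^{-s}$ with $\|f\|_{\mathcal{H}^2}^2=\sum_{n\ge1}|a_n|^2<\infty$, with inner product $\langle\sum a_nn^{-s},\sum b_nn^{-s}\rangle_{\mathcal{H}^2}=\sum a_n\overline{b_n}$. $\mathbf{T}_gf(s)=-\int_s^{+\infty}f(w)g'(w)\,dw$ (integral along the horizontal half-line from $s$, for $\mathrm{Re}\,s$ large enough), which is again a Dirichlet series; it acts boundedly on $\mathcal{H}^2$ if it maps $\mathcal{H}^2$ into itself with finite operator norm. The (multiplicative) Hankel form is $\mathbf{H}_g(fh)=\langle fh,g\rangle_{\mathcal{H}^2}$; it is bounded if there is a constant $C$ such that $|\langle fh,g\rangle_{\mathcal{H}^2}|\le C\|f\|_{\mathcal{H}^2}\|h\|_{\mathcal{H}^2}$ for all Dirichlet polynomials $f,h$. *)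

theory Defs
  imports "HOL-Analysis.Analysis"
begin

text \<open>
  Dirichlet series are handled as functions on \<open>\<complex>\<close> of which only the values in some right
  half-plane matter. Coefficients are indexed by all natural numbers with \<open>a 0 = 0\<close>, so that
  every series over \<open>n\<close> below is a series over \<open>n \<ge> 1\<close>.
\<close>

definition has_dirichlet_series :: "(complex \<Rightarrow> complex) \<Rightarrow> (nat \<Rightarrow> complex) \<Rightarrow> bool" where
  "has_dirichlet_series f a \<longleftrightarrow> a 0 = 0 \<and>
     (\<exists>\<theta>::real. \<forall>s. Re s > \<theta> \<longrightarrow> (\<lambda>n. a n * of_nat n powr (- s)) sums f s)"

definition dirichlet_class :: "(complex \<Rightarrow> complex) set" where
  "dirichlet_class = {f. \<exists>a. has_dirichlet_series f a}"

text \<open>The coefficients are unique, by the uniqueness theorem for Dirichlet series.\<close>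

definition dirichlet_coeff :: "(complex \<Rightarrow> complex) \<Rightarrow> nat \<Rightarrow> complex" where
  "dirichlet_coeff f = (THE a. has_dirichlet_series f a)"

definition hardy2 :: "(complex \<Rightarrow> complex) set" where
  "hardy2 = {f \<in> dirichlet_class. summable (\<lambda>n. (cmod (dirichlet_coeff f n))\<^sup>2)}"

definition hardy2_norm :: "(complex \<Rightarrow> complex) \<Rightarrow> real" where
  "hardy2_norm f = sqrt (\<Sum>n. (cmod (dirichlet_coeff f n))\<^sup>2)"

definition hardy2_inner :: "(complex \<Rightarrow> complex) \<Rightarrow> (complex \<Rightarrow> complex) \<Rightarrow> complex" where
  "hardy2_inner f h = (\<Sum>n. dirichlet_coeff f n * cnj (dirichlet_coeff h n))"

definition dirichlet_polynomial :: "(complex \<Rightarrow> complex) \<Rightarrow> bool" where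
  "dirichlet_polynomial f \<longleftrightarrow> (\<exists>N a. \<forall>s. f s = (\<Sum>n=1..N. a n * of_nat n powr (- s)))"

text \<open>
  The half-line from \<open>s\<close> to \<open>+\<infinity>\<close> is parametrised by \<open>w = s + x\<close>, \<open>x \<ge> 0\<close>. For \<open>f\<close> and \<open>g\<close>
  in \<open>dirichlet_class\<close> the integrand decays exponentially once \<open>Re s\<close> is large, so the integral
  exists there; the values at other \<open>s\<close> are irrelevant.
\<close>

definition volterra :: "(complex \<Rightarrow> complex) \<Rightarrow> (complex \<Rightarrow> complex) \<Rightarrow> complex \<Rightarrow> complex" where
  "volterra g f s = - integral {0..} (\<lambda>x::real. f (s + of_real x) * deriv g (s + of_real x))"

definition volterra_bounded :: "(complex \<Rightarrow> complex) \<Rightarrow> bool" where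
  "volterra_bounded g \<longleftrightarrow>
     (\<exists>C. \<forall>f\<in>hardy2. volterra g f \<in> hardy2 \<and> hardy2_norm (volterra g f) \<le> C * hardy2_norm f)"

text \<open>
  The argument of the Hankel form is the product \<open>f h\<close>. The symbol \<open>g\<close> need not lie in \<open>hardy2\<close>:
  for Dirichlet polynomials \<open>f\<close> and \<open>h\<close> the pairing is a finite sum.
\<close>

definition hankel_form :: "(complex \<Rightarrow> complex) \<Rightarrow> (complex \<Rightarrow> complex) \<Rightarrow> complex" where
  "hankel_form g F = hardy2_inner F g"

definition hankel_bounded :: "(complex \<Rightarrow> complex) \<Rightarrow> bool" where
  "hankel_bounded g \<longleftrightarrow>
     (\<exists>C. \<forall>f h. dirichlet_polynomial f \<longrightarrow> dirichlet_polynomial h \<longrightarrow>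
        cmod (hankel_form g (\<lambda>s. f s * h s)) \<le> C * hardy2_norm f * hardy2_norm h)"

end

theory Submission
  imports Defs
begin

text \<open>
  Differentiating \<open>f h\<close> splits \<open>\<langle>f h, g\<rangle>\<close> into its constant term and the two Littlewood--Paley pairings
  \<open>4 \<integral> x \<langle>f' h, g'\<rangle>\<^sub>x dx\<close> and \<open>4 \<integral> x \<langle>f h', g'\<rangle>\<^sub>x dx\<close> over \<open>x > 0\<close>, where \<open>\<langle>u, v\<rangle>\<^sub>x\<close> is the
  inner product of the translates of \<open>u\<close> and \<open>v\<close> by \<open>x\<close>. In the first pairing, multiplication by \<open>h\<close>
  is moved to the other side; its adjoint applied to \<open>g'\<close> has norm at most the norm of \<open>h g'\<close>, because
  multiplication operators are hyponormal. As \<open>h g'\<close> is the derivative of \<open>T\<^sub>g h\<close>, the Cauchy--Schwarz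
  inequality and the Littlewood--Paley formula bound the pairing by \<open>\<parallel>f\<parallel> \<parallel>T\<^sub>g h\<parallel>\<close>. The second
  pairing is treated in the same way, with \<open>f\<close> and \<open>h\<close> exchanged.
\<close>

section \<open>Dirichlet series: coefficient growth, uniqueness and termwise differentiation\<close>

lemma norm_of_nat_powr: "cmod (of_nat n powr z) = real n powr Re z"
  by (simp add: norm_powr_real_powr)

text \<open>The terms of a convergent series are bounded, and one real point \<open>r\<close> of
  convergence is enough. Polynomial growth gives absolute convergence further to the right.\<close>

lemma has_dirichlet_series_growth:
  assumes "has_dirichlet_series f a"
  obtains M r where "M \<ge> 0" "\<And>n. cmod (a n) \<le> M * real n powr r"
proof -
  from assms obtain \<theta> where a0: "a 0 = 0"
    and sums: "\<And>s. Re s > \<theta> \<Longrightarrow> (\<lambda>n. a n * of_nat n powr (- s)) sums f s"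
    unfolding has_dirichlet_series_def by blast
  define r where "r = \<theta> + 1"
  have "(\<lambda>n. a n * of_nat n powr (- of_real r)) sums f (of_real r)"
    using sums[of "of_real r"] by (simp add: r_def)
  then have "Bseq (\<lambda>n. a n * of_nat n powr (- of_real r))"
    using summable_LIMSEQ_zero[OF sums_summable] by (intro convergent_imp_Bseq convergentI) blast
  then obtain M where M: "M > 0" "\<And>n. cmod (a n * of_nat n powr (- of_real r)) \<le> M"
    using BseqE by blast
  have "cmod (a n) \<le> M * real n powr r" for n
  proof (cases "n = 0")
    case False
    have "cmod (a n) = cmod (a n * of_nat n powr (- of_real r)) * real n powr r"
      using False by (simp add: norm_mult norm_of_nat_powr powr_add[symmetric] mult.assoc)
    also have "\<dots> \<le> M * real n powr r"
      using M by (intro mult_right_mono) auto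
    finally show ?thesis .
  qed (simp add: a0)
  with M(1) show thesis by (intro that[of M r]) auto
qed

lemma dirichlet_term_bound:
  assumes "cmod (a n) \<le> M * real n powr r"
  shows "cmod (a n * of_nat n powr (- s)) \<le> M * real n powr (r - Re s)"
proof -
  have "cmod (a n * of_nat n powr (- s)) \<le> M * real n powr r * real n powr (- Re s)"
    unfolding norm_mult norm_of_nat_powr uminus_complex.simps by (intro mult_right_mono assms) auto
  then show ?thesis by (simp add: mult.assoc powr_add[symmetric])
qed

lemma dirichlet_summable_norm:
  assumes "\<And>n. cmod (a n) \<le> M * real n powr r" "Re s > r + 1"
  shows "summable (\<lambda>n. cmod (a n * of_nat n powr (- s)))"
proof (rule summable_comparison_test')
  show "summable (\<lambda>n. M * real n powr (r - Re s))"
    using assms(2) by (intro summable_mult) (simp add: summable_real_powr_iff)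
  show "norm (cmod (a n * of_nat n powr (- s))) \<le> M * real n powr (r - Re s)" for n
    using dirichlet_term_bound[of a n M r s] assms(1)[of n] by simp
qed

lemma has_dirichlet_series_suminf:
  assumes "\<And>n. cmod (a n) \<le> M * real n powr r"
  shows "has_dirichlet_series (\<lambda>s. \<Sum>n. a n * of_nat n powr (- s)) a"
  unfolding has_dirichlet_series_def
proof (intro conjI exI[of _ "r + 1"] allI impI)
  show "a 0 = 0" using assms[of 0] by simp
  fix s assume "Re s > r + 1"
  then show "(\<lambda>n. a n * of_nat n powr (- s)) sums (\<Sum>n. a n * of_nat n powr (- s))"
    by (intro summable_sums summable_norm_cancel[OF dirichlet_summable_norm[OF assms]])
qed

text \<open>Split n^(r - Re s) as n^(r + 2 - Re s) times n^(-2). For Re s > r + 2 the first factor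
  is largest at the first index \<open>m\<close>, and the second is summable. This is used with
  \<open>m = Suc n\<close> for uniqueness and with \<open>m = 2\<close> for vanishing at
  +\<infinity>.\<close>

lemma has_dirichlet_series_decay:
  assumes "has_dirichlet_series f a" "\<And>n. n < m \<Longrightarrow> a n = 0" "m \<ge> 1"
  shows "\<exists>C \<theta>. \<forall>s. Re s > \<theta> \<longrightarrow> cmod (f s) \<le> C * real m powr (- Re s)"
proof -
  from assms(1) obtain \<theta>0 where
    sums: "\<And>s. Re s > \<theta>0 \<Longrightarrow> (\<lambda>n. a n * of_nat n powr (- s)) sums f s"
    unfolding has_dirichlet_series_def by blast
  obtain M r where M: "M \<ge> 0" "\<And>n. cmod (a n) \<le> M * real n powr r"
    using has_dirichlet_series_growth[OF assms(1)] by blast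
  define S where "S = (\<Sum>n. real n powr (- 2))"
  have S: "summable (\<lambda>n. real n powr (- 2))"
    by (simp add: summable_real_powr_iff)
  have "cmod (f s) \<le> M * S * real m powr (r + 2) * real m powr (- Re s)"
    if s: "Re s > max \<theta>0 (r + 2)" for s
  proof -
    have bnd: "cmod (a n * of_nat n powr (- s))
        \<le> M * real m powr (r + 2 - Re s) * real n powr (- 2)" for n
    proof (cases "n < m")
      case False
      with assms(3) have n: "n \<ge> m" "real n > 0" by auto
      have "cmod (a n * of_nat n powr (- s)) \<le> M * real n powr (r - Re s)"
        using M by (intro dirichlet_term_bound)
      also have "real n powr (r - Re s) = real n powr (r + 2 - Re s) * real n powr (- 2)"
        using n by (simp add: powr_add[symmetric] del: powr_numeral)
      also have "real n powr (r + 2 - Re s) \<le> real m powr (r + 2 - Re s)"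
        using n s assms(3) by (intro powr_mono2') auto
      finally show ?thesis using M(1) by (simp add: mult_left_mono mult_right_mono mult.assoc)
    qed (use assms(2) M(1) in auto)
    have "cmod (f s) \<le> (\<Sum>n. M * real m powr (r + 2 - Re s) * real n powr (- 2))"
      using norm_suminf_le[OF bnd summable_mult[OF S]] sums[of s] s by (simp add: sums_iff)
    also have "\<dots> = M * real m powr (r + 2 - Re s) * S"
      unfolding S_def by (rule suminf_mult[OF S])
    also have "real m powr (r + 2 - Re s) = real m powr (r + 2) * real m powr (- Re s)"
      by (simp add: powr_add[symmetric])
    finally show ?thesis by (simp add: mult_ac)
  qed
  then show ?thesis by blast
qed

text \<open>Strong induction: if all coefficients before \<open>n\<close> vanish, the
  \<open>n\<close>-th term is minus a series starting at \<open>Suc n\<close>. That series decays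
  too fast for a nonzero multiple of n^(-s).\<close>

lemma has_dirichlet_series_zero:
  assumes "has_dirichlet_series (\<lambda>s. 0) a"
  shows "a n = 0"
proof (induction n rule: less_induct)
  case (less n)
  show ?case
  proof (cases "n = 0")
    case True
    with assms show ?thesis by (simp add: has_dirichlet_series_def)
  next
    case False
    from assms obtain \<theta>0 where
      sums: "\<And>s. Re s > \<theta>0 \<Longrightarrow> (\<lambda>n. a n * of_nat n powr (- s)) sums 0"
      unfolding has_dirichlet_series_def by blast
    define b where "b = a(n := 0)"
    have "(\<lambda>k. b k * of_nat k powr (- s)) sums (- (a n * of_nat n powr (- s)))"
      if "Re s > \<theta>0" for s
    proof -
      have "(\<lambda>k. (if k = n then a n * of_nat n powr (- s) else 0)) sums (a n * of_nat n powr (- s))"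
        by (rule sums_single)
      from sums_diff[OF sums[OF that] this]
      have "(\<lambda>k. a k * of_nat k powr (- s) - (if k = n then a n * of_nat n powr (- s) else 0))
          sums (- (a n * of_nat n powr (- s)))" by simp
      moreover have "(\<lambda>k. a k * of_nat k powr (- s) - (if k = n then a n * of_nat n powr (- s) else 0))
          = (\<lambda>k. b k * of_nat k powr (- s))"
        by (auto simp: b_def)
      ultimately show ?thesis by simp
    qed
    then have "has_dirichlet_series (\<lambda>s. - (a n * of_nat n powr (- s))) b"
      using assms False unfolding has_dirichlet_series_def b_def by (intro conjI exI[of _ \<theta>0]) auto
    moreover have "b k = 0" if "k < Suc n" for k
      using that less by (auto simp: b_def less_Suc_eq)
    ultimately obtain C \<theta> where C:
      "\<And>s. Re s > \<theta> \<Longrightarrow> cmod (- (a n * of_nat n powr (- s))) \<le> C * real (Suc n) powr (- Re s)"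
      using has_dirichlet_series_decay[of "\<lambda>s. - (a n * of_nat n powr (- s))" b "Suc n"] by auto
    \<comment> \<open>Evaluating the decay bound at s = j and multiplying by n^j leaves geometric
      decay with ratio \<open>q\<close>.\<close>
    define q where "q = real n / real (Suc n)"
    have q: "0 < q" "q < 1" using False by (auto simp: q_def)
    have "cmod (a n) \<le> C * q ^ j" if "real j > \<theta>" for j
    proof -
      have "cmod (a n) * real n powr (- real j) \<le> C * real (Suc n) powr (- real j)"
        using C[of "of_nat j"] that by (simp add: norm_mult norm_of_nat_powr)
      then show ?thesis
        using False
        by (simp add: powr_minus powr_realpow q_def power_divide field_simps del: of_nat_Suc)
    qed
    then have "\<forall>\<^sub>F j in sequentially. cmod (a n) \<le> C * q ^ j"
      using filterlim_real_sequentially unfolding filterlim_at_top_dense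
      by (blast intro: eventually_mono)
    moreover have "(\<lambda>j. C * q ^ j) \<longlonglongrightarrow> C * 0"
      using q by (intro tendsto_mult tendsto_const LIMSEQ_realpow_zero) auto
    ultimately have "cmod (a n) \<le> 0"
      using tendsto_lowerbound by fastforce
    then show ?thesis by simp
  qed
qed

lemma has_dirichlet_series_unique:
  assumes "has_dirichlet_series f a" "has_dirichlet_series f b"
  shows "a = b"
proof -
  from assms obtain \<theta>1 \<theta>2 where sums:
    "\<And>s. Re s > \<theta>1 \<Longrightarrow> (\<lambda>n. a n * of_nat n powr (- s)) sums f s"
    "\<And>s. Re s > \<theta>2 \<Longrightarrow> (\<lambda>n. b n * of_nat n powr (- s)) sums f s"
    unfolding has_dirichlet_series_def by blast
  have "(\<lambda>n. (a n - b n) * of_nat n powr (- s)) sums 0" if "Re s > max \<theta>1 \<theta>2" for s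
    using that sums_diff[OF sums(1)[of s] sums(2)[of s]] by (simp add: algebra_simps)
  moreover have "a 0 - b 0 = 0" using assms by (simp add: has_dirichlet_series_def)
  ultimately have "has_dirichlet_series (\<lambda>s. 0) (\<lambda>n. a n - b n)"
    unfolding has_dirichlet_series_def by blast
  from has_dirichlet_series_zero[OF this] show ?thesis by auto
qed

lemma dirichlet_coeff_eqI: "has_dirichlet_series f a \<Longrightarrow> dirichlet_coeff f = a"
  unfolding dirichlet_coeff_def by (blast intro: has_dirichlet_series_unique)

text \<open>Since ln n \<le> n, differentiation raises the growth exponent by at most one. The
  derived series is then dominated by a multiple of n^(-2) on Re s > r + 3, so termwise
  differentiation applies there.\<close>

lemma has_dirichlet_series_deriv:
  assumes "has_dirichlet_series f a"
  shows "\<exists>\<theta>. \<forall>s. Re s > \<theta> \<longrightarrow> (f has_field_derivative deriv f s) (at s)"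
    and "has_dirichlet_series (deriv f) (\<lambda>n. - of_real (ln (real n)) * a n)"
proof -
  from assms obtain \<theta>0 where a0: "a 0 = 0" and
    sums: "\<And>s. Re s > \<theta>0 \<Longrightarrow> (\<lambda>n. a n * of_nat n powr (- s)) sums f s"
    unfolding has_dirichlet_series_def by blast
  obtain M r where M: "M \<ge> 0" "\<And>n. cmod (a n) \<le> M * real n powr r"
    using has_dirichlet_series_growth[OF assms] by blast
  define b where "b = (\<lambda>n. - of_real (ln (real n)) * a n)"
  have b: "cmod (b n) \<le> M * real n powr (r + 1)" for n
  proof (cases "n = 0")
    case False
    then have "\<bar>ln (real n)\<bar> \<le> real n powr 1"
      using ln_powr_bound[of "real n" 1] by simp
    then have "\<bar>ln (real n)\<bar> * cmod (a n) \<le> real n powr 1 * (M * real n powr r)"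
      using M by (intro mult_mono) auto
    then show ?thesis by (simp add: b_def norm_mult powr_add mult_ac)
  qed (simp add: b_def)
  define \<theta> where "\<theta> = max \<theta>0 (r + 3)"
  define S where "S = {s. Re s > \<theta>}"
  have S: "open S" "convex S" unfolding S_def by (auto intro: open_halfspace_Re_gt convex_halfspace_Re_gt)
  have conv: "uniformly_convergent_on S (\<lambda>n s. \<Sum>i<n. b i * of_nat i powr (- s))"
  proof (rule Weierstrass_m_test')
    show "cmod (b n * of_nat n powr (- s)) \<le> M * real n powr (- 2)" if "s \<in> S" for n s
    proof -
      have "cmod (b n * of_nat n powr (- s)) \<le> M * real n powr (r + 1 - Re s)"
        by (intro dirichlet_term_bound b)
      also have "\<dots> \<le> M * real n powr (- 2)"
      proof (cases "n = 0")
        case False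
        with that M show ?thesis
          by (intro mult_left_mono powr_mono) (auto simp: S_def \<theta>_def)
      qed simp
      finally show ?thesis .
    qed
    show "summable (\<lambda>n. M * real n powr (- 2))"
      by (intro summable_mult) (simp add: summable_real_powr_iff)
  qed
  have der: "((\<lambda>s. a n * of_nat n powr (- s)) has_field_derivative b n * of_nat n powr (- s))
      (at s within S)" for n s
  proof (cases "n = 0")
    case False
    then have "Ln (of_nat n) = of_real (ln (real n))"
      using Ln_of_real[of "real n"] by simp
    moreover have "((\<lambda>s. of_nat n powr (- s)) has_field_derivative
        - (Ln (of_nat n) * of_nat n powr (- s))) (at s within S)" for s
      using DERIV_chain'[OF DERIV_minus[OF DERIV_ident]
          has_field_derivative_powr_right[of "of_nat n"], of s S] False by simp
    ultimately show ?thesis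
      using DERIV_cmult[of "\<lambda>s. of_nat n powr (- s)" "- (Ln (of_nat n) * of_nat n powr (- s))" s S "a n"]
      by (simp add: b_def mult_ac)
  qed (simp add: a0 b_def)
  have main: "(f has_field_derivative (\<Sum>n. b n * of_nat n powr (- s))) (at s)" if "s \<in> S" for s
  proof -
    have "((\<lambda>s. \<Sum>n. a n * of_nat n powr (- s)) has_field_derivative
      (\<Sum>n. b n * of_nat n powr (- s))) (at s)"
      using that S sums[of s]
      by (intro has_field_derivative_series'(2)[OF S(2) der conv that])
         (auto simp: interior_open S_def \<theta>_def intro: sums_summable)
    then show ?thesis
      by (rule has_field_derivative_transform_within_open[OF _ S(1) that])
         (use sums in \<open>auto simp: S_def \<theta>_def sums_iff\<close>)
  qed
  then have d: "deriv f s = (\<Sum>n. b n * of_nat n powr (- s))" if "s \<in> S" for s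
    using that DERIV_imp_deriv by blast
  from main d show "\<exists>\<theta>. \<forall>s. Re s > \<theta> \<longrightarrow> (f has_field_derivative deriv f s) (at s)"
    by (metis S_def mem_Collect_eq)
  have "(\<lambda>n. b n * of_nat n powr (- s)) sums deriv f s" if "Re s > \<theta>" for s
  proof -
    have "summable (\<lambda>n. b n * of_nat n powr (- s))"
      using that by (intro summable_norm_cancel[OF dirichlet_summable_norm[OF b]]) (auto simp: \<theta>_def)
    with d[of s] that show ?thesis by (simp add: S_def sums_iff)
  qed
  then show "has_dirichlet_series (deriv f) (\<lambda>n. - of_real (ln (real n)) * a n)"
    unfolding has_dirichlet_series_def b_def by (intro conjI exI[of _ \<theta>]) (auto simp: a0)
qed

section \<open>Dilations and products with Dirichlet polynomials\<close>

text \<open>The coefficients of \<open>k\<^sup>-\<^sup>s u(s)\<close>; for \<open>k > 0\<close> these are commuting isometries of \<open>\<ell>\<^sup>2\<close>.\<close>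

definition dilate :: "nat \<Rightarrow> (nat \<Rightarrow> complex) \<Rightarrow> nat \<Rightarrow> complex" where
  "dilate k u m = (if k dvd m then u (m div k) else 0)"

lemma dilate_mult [simp]: "k > 0 \<Longrightarrow> dilate k u (k * m) = u m"
  by (simp add: dilate_def)

lemma dilate_0 [simp]: "dilate k u 0 = u 0"
  by (simp add: dilate_def)

text \<open>A series supported on the multiples of \<open>k\<close> can be reindexed along the
  strictly increasing map m \<mapsto> k m. The sums over dilated sequences below are evaluated this
  way.\<close>

lemma dilate_sums:
  assumes "k > 0" "\<And>m. F (k * m) = G m" "\<And>m. \<not> k dvd m \<Longrightarrow> F m = 0" "G sums S"
  shows "F sums (S :: 'a :: real_normed_vector)"
proof -
  have "strict_mono ((*) k)" using assms(1) by (auto simp: strict_mono_def)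
  moreover have "F m = 0" if "m \<notin> range ((*) k)" for m
    using assms(3)[of m] that by (auto simp: dvd_def)
  ultimately show ?thesis
    using sums_mono_reindex[of "(*) k" F S] assms(2,4) by simp
qed

text \<open>The product is a finite combination of the series k^(-s) h(s), each convergent wherever
  the series of \<open>h\<close> is; no double series has to be rearranged.\<close>

lemma has_dirichlet_series_mult_polynomial:
  assumes f: "\<And>s. f s = (\<Sum>k=1..N. a k * of_nat k powr (- s))"
    and h: "has_dirichlet_series h b"
  shows "has_dirichlet_series (\<lambda>s. f s * h s) (\<lambda>m. \<Sum>k=1..N. a k * dilate k b m)"
proof -
  from h obtain \<theta> where b0: "b 0 = 0" and
    sums: "\<And>s. Re s > \<theta> \<Longrightarrow> (\<lambda>n. b n * of_nat n powr (- s)) sums h s"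
    unfolding has_dirichlet_series_def by blast
  have "(\<lambda>m. (\<Sum>k=1..N. a k * dilate k b m) * of_nat m powr (- s)) sums (f s * h s)"
    if s: "Re s > \<theta>" for s
  proof -
    have "(\<lambda>m. a k * (dilate k b m * of_nat m powr (- s))) sums (a k * (of_nat k powr (- s) * h s))"
      if k: "k \<in> {1..N}" for k
    proof (rule sums_mult, rule dilate_sums[where k = k])
      show "(\<lambda>n. of_nat k powr (- s) * (b n * of_nat n powr (- s))) sums (of_nat k powr (- s) * h s)"
        using sums[OF s] by (rule sums_mult)
      show "dilate k b (k * n) * of_nat (k * n) powr (- s)
          = of_nat k powr (- s) * (b n * of_nat n powr (- s))" for n
        using k by (simp add: powr_times_real)
    qed (use k in \<open>auto simp: dilate_def\<close>)
    then have "(\<lambda>m. \<Sum>k=1..N. a k * (dilate k b m * of_nat m powr (- s)))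
        sums (\<Sum>k=1..N. a k * (of_nat k powr (- s) * h s))"
      by (rule sums_sum)
    then show ?thesis by (simp add: f sum_distrib_right sum_distrib_left mult_ac)
  qed
  then show ?thesis
    unfolding has_dirichlet_series_def by (intro conjI exI[of _ \<theta>]) (auto simp: b0)
qed

lemma has_dirichlet_series_polynomial:
  assumes f: "\<And>s. f s = (\<Sum>k=1..N. a k * of_nat k powr (- s))"
  shows "has_dirichlet_series f (\<lambda>m. if m \<in> {1..N} then a m else 0)"
proof -
  have "(\<lambda>m. (if m \<in> {1..N} then a m else 0) * of_nat m powr (- s)) sums f s" for s
    unfolding f
    using sums_If_finite_set[of "{1..N}" "\<lambda>m. a m * of_nat m powr (- s)"]
    by (simp add: if_distrib[of "\<lambda>x. x * _"] cong: if_cong)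
  then show ?thesis unfolding has_dirichlet_series_def by auto
qed

section \<open>Dirichlet series of the Volterra operator\<close>

text \<open>The integral over \<open>{0..b}\<close> is \<open>F b - F 0\<close>, and
  \<open>F b\<close> tends to 0. The gauge integral over a half-line only tests large bounded
  intervals, so absolute integrability does not enter.\<close>

lemma has_integral_atLeast_FTC:
  fixes F :: "real \<Rightarrow> complex"
  assumes der: "\<And>x. x \<ge> 0 \<Longrightarrow> (F has_vector_derivative f x) (at x within {0..})"
    and lim: "(F \<longlongrightarrow> 0) at_top"
  shows "(f has_integral (- F 0)) {0..}"
proof (subst has_integral', intro allI impI)
  fix e :: real assume e: "e > 0"
  from tendstoD[OF lim e] obtain B0 where B0: "\<And>x. x \<ge> B0 \<Longrightarrow> cmod (F x) < e"
    unfolding eventually_at_top_linorder by auto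
  define B where "B = max B0 1"
  show "\<exists>B>0. \<forall>a b. ball 0 B \<subseteq> cbox a b \<longrightarrow>
      (\<exists>z. ((\<lambda>x. if x \<in> {0..} then f x else 0) has_integral z) (cbox a b) \<and> cmod (z - - F 0) < e)"
  proof (intro exI[of _ B] conjI allI impI)
    show "B > 0" by (simp add: B_def)
    fix a b :: real assume "ball 0 B \<subseteq> cbox a b"
    then have "{- B<..<B} \<subseteq> {a..b}" by (simp add: ball_eq_greaterThanLessThan)
    then have ab: "a \<le> 0" "B \<le> b"
      using \<open>B > 0\<close> by (auto simp: greaterThanLessThan_subseteq_atLeastAtMost_iff)
    have "(f has_integral (F b - F 0)) {0..b}"
      using ab \<open>B > 0\<close>
      by (intro fundamental_theorem_of_calculus has_vector_derivative_within_subset[OF der]) auto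
    then have "((\<lambda>x. if x \<in> {0..b} then f x else 0) has_integral (F b - F 0)) {a..b}"
      using ab by (subst has_integral_restrict) auto
    then have "((\<lambda>x. if x \<in> {0..} then f x else 0) has_integral (F b - F 0)) {a..b}"
      by (rule has_integral_eq[rotated]) auto
    moreover have "cmod (F b - F 0 - - F 0) < e" using B0[of b] ab by (simp add: B_def)
    ultimately show "\<exists>z. ((\<lambda>x. if x \<in> {0..} then f x else 0) has_integral z) (cbox a b) \<and>
        cmod (z - - F 0) < e" by auto
  qed
qed

text \<open>The candidate series \<open>E\<close> is built from the stated coefficients
  \<open>e\<close>. Its derivative has the coefficients of f g', and it vanishes at +\<infinity>, so
  the fundamental theorem identifies it with \<open>volterra g f\<close>.\<close>

lemma has_dirichlet_series_volterra:
  assumes f: "\<And>s. f s = (\<Sum>k=1..N. b k * of_nat k powr (- s))"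
    and g: "has_dirichlet_series g c"
  shows "has_dirichlet_series (volterra g f)
    (\<lambda>m. (\<Sum>k=1..N. b k * dilate k (\<lambda>n. of_real (ln (real n)) * c n) m) / of_real (ln (real m)))"
proof -
  define p where "p = (\<lambda>m. \<Sum>k=1..N. b k * dilate k (\<lambda>n. of_real (ln (real n)) * c n) m)"
  define e where "e = (\<lambda>m. p m / of_real (ln (real m)))"
  have "has_dirichlet_series (\<lambda>s. f s * deriv g s)
      (\<lambda>m. \<Sum>k=1..N. b k * dilate k (\<lambda>n. - of_real (ln (real n)) * c n) m)"
    using f has_dirichlet_series_deriv(2)[OF g] by (rule has_dirichlet_series_mult_polynomial)
  also have "(\<lambda>m. \<Sum>k=1..N. b k * dilate k (\<lambda>n. - of_real (ln (real n)) * c n) m) = (\<lambda>m. - p m)"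
    by (auto simp: p_def dilate_def sum_negf[symmetric] intro!: sum.cong)
  finally have fg: "has_dirichlet_series (\<lambda>s. f s * deriv g s) (\<lambda>m. - p m)" .
  have p0: "p 0 = 0" using fg by (simp add: has_dirichlet_series_def)
  have p1: "p 1 = 0" unfolding p_def by (intro sum.neutral) (auto simp: dilate_def)
  \<comment> \<open>Dividing by \<open>ln (real m)\<close> loses nothing: the logarithm is 0 at
    \<open>m = 0\<close> and \<open>m = 1\<close>, but there \<open>p m\<close> is 0 as
    well.\<close>
  have pe: "p m = of_real (ln (real m)) * e m" for m
    using p0 p1 by (cases "m = 0 \<or> m = 1") (auto simp: e_def)
  obtain M r where M: "M \<ge> 0" "\<And>n. cmod (- p n) \<le> M * real n powr r"
    using has_dirichlet_series_growth[OF fg] by blast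
  have "cmod (e n) \<le> (M / ln 2) * real n powr r" for n
  proof (cases "n \<le> 1")
    case True
    then have "e n = 0" using p0 p1 by (cases n) (auto simp: e_def)
    with M(1) show ?thesis by simp
  next
    case False
    then have "ln (real n) \<ge> ln 2" by simp
    moreover have "ln (2::real) > 0" by simp
    ultimately have "cmod (p n) / \<bar>ln (real n)\<bar> \<le> (M * real n powr r) / ln 2"
      using M by (intro frac_le) auto
    then show ?thesis by (simp add: e_def norm_divide)
  qed
  then have E: "has_dirichlet_series (\<lambda>s. \<Sum>n. e n * of_nat n powr (- s)) e"
    by (rule has_dirichlet_series_suminf)
  define E where "E = (\<lambda>s. \<Sum>n. e n * of_nat n powr (- s))"
  note E = E[folded E_def]
  have dE: "has_dirichlet_series (deriv E) (\<lambda>n. - p n)"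
    using has_dirichlet_series_deriv(2)[OF E] by (simp add: pe)
  obtain \<theta>1 where 1: "\<And>s. Re s > \<theta>1 \<Longrightarrow> (E has_field_derivative deriv E s) (at s)"
    using has_dirichlet_series_deriv(1)[OF E] by blast
  from dE obtain \<theta>2 where
    2: "\<And>s. Re s > \<theta>2 \<Longrightarrow> (\<lambda>n. - p n * of_nat n powr (- s)) sums deriv E s"
    unfolding has_dirichlet_series_def by blast
  from fg obtain \<theta>3 where
    3: "\<And>s. Re s > \<theta>3 \<Longrightarrow> (\<lambda>n. - p n * of_nat n powr (- s)) sums (f s * deriv g s)"
    unfolding has_dirichlet_series_def by blast
  \<comment> \<open>With no constant term, \<open>E\<close> is of order 2^(-Re s). This fixes the
    constant of integration.\<close>
  have "e n = 0" if "n < 2" for n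
    using p0 p1 that by (cases n) (auto simp: e_def)
  then obtain C \<theta>4 where C:
    "\<And>s. Re s > \<theta>4 \<Longrightarrow> cmod (E s) \<le> C * 2 powr (- Re s)"
    using has_dirichlet_series_decay[OF E, of 2] by auto
  from E obtain \<theta>5 where
    5: "\<And>s. Re s > \<theta>5 \<Longrightarrow> (\<lambda>n. e n * of_nat n powr (- s)) sums E s"
    unfolding has_dirichlet_series_def by blast
  define \<theta> where "\<theta> = Max {\<theta>1, \<theta>2, \<theta>3, \<theta>4, \<theta>5}"
  have \<theta>: "\<theta>1 \<le> \<theta>" "\<theta>2 \<le> \<theta>" "\<theta>3 \<le> \<theta>" "\<theta>4 \<le> \<theta>" "\<theta>5 \<le> \<theta>" unfolding \<theta>_def by auto
  have "(\<lambda>n. e n * of_nat n powr (- s)) sums volterra g f s" if s: "Re s > \<theta>" for s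
  proof -
    have der: "((\<lambda>x. E (s + of_real x)) has_vector_derivative f (s + of_real x) * deriv g (s + of_real x))
        (at x within {0..})" if "x \<ge> 0" for x
    proof -
      have eq: "f (s + of_real x) * deriv g (s + of_real x) = deriv E (s + of_real x)"
        using 2[of "s + of_real x"] 3[of "s + of_real x"] s that \<theta> by (auto simp: sums_iff)
      have "(E has_field_derivative deriv E (s + of_real x)) (at (s + of_real x))"
        using s that \<theta> by (intro 1) auto
      moreover have "((\<lambda>x. s + complex_of_real x) has_vector_derivative 1) (at x within {0..})"
        by (auto intro!: derivative_eq_intros)
      ultimately show ?thesis
        using field_vector_diff_chain_within[of "\<lambda>x. s + complex_of_real x" 1 x "{0..}" E]
        by (auto simp: o_def eq intro: has_field_derivative_at_within)
    qed
    have "((\<lambda>x. E (s + of_real x)) \<longlongrightarrow> 0) at_top"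
    proof (rule Lim_null_comparison)
      show "\<forall>\<^sub>F x in at_top. cmod (E (s + of_real x)) \<le> C * 2 powr (- (Re s + x))"
        using eventually_ge_at_top[of 0]
      proof eventually_elim
        case (elim x)
        then show ?case using C[of "s + of_real x"] s \<theta> by auto
      qed
      have "filterlim (\<lambda>x. ln 2 * (Re s + x)) at_top at_top"
        by (intro filterlim_tendsto_pos_mult_at_top[OF tendsto_const]
              filterlim_tendsto_add_at_top[OF tendsto_const] filterlim_ident) simp
      then have "filterlim (\<lambda>x. - (ln 2 * (Re s + x))) at_bot at_top"
        by (simp add: filterlim_uminus_at_bot)
      from filterlim_compose[OF exp_at_bot this]
      have "((\<lambda>x. 2 powr (- (Re s + x))) \<longlongrightarrow> 0) at_top"
        by (simp add: powr_def algebra_simps)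
      then show "((\<lambda>x. C * 2 powr (- (Re s + x))) \<longlongrightarrow> 0) at_top"
        using tendsto_mult_right_zero by blast
    qed
    \<comment> \<open>The integral equals \<open>- E s\<close>, and the sign in the definition of
      \<open>volterra\<close> cancels the minus.\<close>
    from has_integral_atLeast_FTC[OF der this] have "volterra g f s = E s"
      unfolding volterra_def by (simp add: integral_unique)
    with 5[of s] s \<theta> show ?thesis by simp
  qed
  then show ?thesis
    using E unfolding has_dirichlet_series_def e_def p_def by blast
qed

section \<open>Square-summable sequences and hyponormality\<close>

abbreviation square_summable :: "(nat \<Rightarrow> complex) \<Rightarrow> bool" where
  "square_summable u \<equiv> summable (\<lambda>n. (cmod (u n))\<^sup>2)"

definition ell2_inner :: "(nat \<Rightarrow> complex) \<Rightarrow> (nat \<Rightarrow> complex) \<Rightarrow> complex" where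
  "ell2_inner u v = (\<Sum>n. u n * cnj (v n))"

lemma ell2_inner_sums:
  assumes "square_summable u" "square_summable v"
  shows "(\<lambda>n. u n * cnj (v n)) sums ell2_inner u v"
  unfolding ell2_inner_def
proof (rule summable_sums, rule summable_comparison_test)
  show "summable (\<lambda>n. (cmod (u n))\<^sup>2 + (cmod (v n))\<^sup>2)"
    using assms by (rule summable_add)
  have "2 * (x * y) \<le> x\<^sup>2 + y\<^sup>2" for x y :: real
    using zero_le_power2[of "x - y"] by (simp add: power2_diff)
  then have "x * y \<le> x\<^sup>2 + y\<^sup>2" if "x \<ge> 0" "y \<ge> 0" for x y :: real
    using that mult_nonneg_nonneg[OF that] by (smt (verit))
  then show "\<exists>N. \<forall>n\<ge>N. cmod (u n * cnj (v n)) \<le> (cmod (u n))\<^sup>2 + (cmod (v n))\<^sup>2"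
    by (simp add: norm_mult)
qed

lemma square_summable_add:
  assumes "square_summable u" "square_summable v"
  shows "square_summable (\<lambda>n. u n + v n)"
proof (rule summable_comparison_test)
  show "summable (\<lambda>n. 2 * (cmod (u n))\<^sup>2 + 2 * (cmod (v n))\<^sup>2)"
    using assms by (intro summable_add summable_mult)
  have "(cmod (x + y))\<^sup>2 \<le> 2 * (cmod x)\<^sup>2 + 2 * (cmod y)\<^sup>2" for x y
  proof -
    have "(cmod (x + y))\<^sup>2 \<le> (cmod x + cmod y)\<^sup>2"
      by (intro power_mono norm_triangle_ineq) auto
    also have "\<dots> \<le> 2 * (cmod x)\<^sup>2 + 2 * (cmod y)\<^sup>2"
      using zero_le_power2[of "cmod x - cmod y"] by (simp add: power2_diff power2_sum)
    finally show ?thesis .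
  qed
  then show "\<exists>N. \<forall>n\<ge>N. norm ((cmod (u n + v n))\<^sup>2) \<le> 2 * (cmod (u n))\<^sup>2 + 2 * (cmod (v n))\<^sup>2"
    by simp
qed

lemma square_summable_cmult: "square_summable u \<Longrightarrow> square_summable (\<lambda>n. c * u n)"
  by (simp add: norm_mult power_mult_distrib summable_mult)

lemma square_summable_combination:
  assumes "finite A" "\<And>k. k \<in> A \<Longrightarrow> square_summable (w k)"
  shows "square_summable (\<lambda>n. \<Sum>k\<in>A. c k * w k n)"
  using assms
proof (induction A rule: finite_induct)
  case (insert x F)
  then have "square_summable (\<lambda>n. c x * w x n)" "square_summable (\<lambda>n. \<Sum>k\<in>F. c k * w k n)"
    by (auto intro: square_summable_cmult)
  from square_summable_add[OF this] insert.hyps show ?case by simp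
qed simp

text \<open>Reduces a squared norm to the Gram matrix of the \<open>w k\<close>, so that two
  combinations can be compared through inner products alone.\<close>

lemma norm2_combination_sums:
  assumes "\<And>k. k \<in> A \<Longrightarrow> square_summable (w k)"
  shows "(\<lambda>n. of_real ((cmod (\<Sum>k\<in>A. c k * w k n))\<^sup>2)) sums
    (\<Sum>k\<in>A. \<Sum>l\<in>A. c k * cnj (c l) * ell2_inner (w k) (w l))"
proof -
  have "(\<lambda>n. \<Sum>k\<in>A. \<Sum>l\<in>A. c k * cnj (c l) * (w k n * cnj (w l n))) sums
    (\<Sum>k\<in>A. \<Sum>l\<in>A. c k * cnj (c l) * ell2_inner (w k) (w l))"
    by (rule sums_sum, rule sums_sum, rule sums_mult, rule ell2_inner_sums) (auto intro: assms)
  then show ?thesis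
    by (simp only: complex_norm_square cnj_sum sum_product complex_cnj_mult mult_ac)
qed

lemma square_summable_dilate:
  assumes "k > 0" "square_summable u"
  shows "square_summable (dilate k u)"
  using dilate_sums[OF assms(1), of "\<lambda>m. (cmod (dilate k u m))\<^sup>2" "\<lambda>m. (cmod (u m))\<^sup>2"] assms
  by (auto simp: dilate_def summable_def)

lemma ell2_inner_dilate:
  assumes "k > 0" "square_summable u" "square_summable v"
  shows "ell2_inner (dilate k u) (dilate k v) = ell2_inner u v"
  using dilate_sums[OF assms(1), of "\<lambda>m. dilate k u m * cnj (dilate k v m)"
      "\<lambda>m. u m * cnj (v m)"] assms ell2_inner_sums[OF assms(2,3)]
  by (auto simp: dilate_def ell2_inner_def sums_iff)

lemma dilate_dilate: "k > 0 \<Longrightarrow> l > 0 \<Longrightarrow> dilate k (dilate l u) = dilate (k * l) u"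
  by (auto simp: dilate_def fun_eq_iff div_mult2_eq dvd_mult_div_cancel elim!: dvdE)

text \<open>Dilation is isometric: dilating the left pair by \<open>q'\<close> and the right pair by
  \<open>q\<close> produces the same pair. Hence the inner product depends only on the ratio of the
  two indices.\<close>

lemma ell2_inner_dilate_ratio:
  assumes "p > 0" "q > 0" "p' > 0" "q' > 0" "p * q' = p' * q" "square_summable v"
  shows "ell2_inner (dilate p v) (dilate q v) = ell2_inner (dilate p' v) (dilate q' v)"
proof -
  have "ell2_inner (dilate p v) (dilate q v) = ell2_inner (dilate (q' * p) v) (dilate (q' * q) v)"
    using assms ell2_inner_dilate[of q' "dilate p v" "dilate q v"]
    by (simp add: dilate_dilate square_summable_dilate)
  also have "q' * p = q * p'" using assms(5) by (simp add: mult.commute)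
  also have "q' * q = q * q'" by simp
  also have "ell2_inner (dilate (q * p') v) (dilate (q * q') v) = ell2_inner (dilate p' v) (dilate q' v)"
    using assms ell2_inner_dilate[of q "dilate p' v" "dilate q' v"]
    by (simp add: dilate_dilate square_summable_dilate)
  finally show ?thesis .
qed

text \<open>
  Hyponormality: up to the isometry \<open>dilate K\<close> with \<open>K = N!\<close>, the adjoint of \<open>dilate k\<close> is
  \<open>dilate (K div k)\<close>, and the norms then agree by \<open>ell2_inner_dilate_ratio\<close>.
\<close>

lemma norm2_adjoint_le:
  assumes v: "square_summable v"
  shows "(\<Sum>j=1..J. (cmod (\<Sum>k=1..N. cnj (b k) * v (j * k)))\<^sup>2)
    \<le> (\<Sum>m. (cmod (\<Sum>k=1..N. b k * dilate k v m))\<^sup>2)"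
proof -
  \<comment> \<open>Any common multiple of 1, ..., N would serve. It makes every value
    \<open>v (j * k)\<close> a value of \<open>dilate (K div k) v\<close> at the same index
    \<open>K * j\<close>.\<close>
  define K :: nat where "K = fact N"
  define y where "y = (\<lambda>m. \<Sum>k=1..N. cnj (b k) * dilate (K div k) v m)"
  have K: "k dvd K" "K div k > 0" "K div k * k = K" if "k \<in> {1..N}" for k
  proof -
    show "k dvd K" using that by (auto simp: K_def intro: dvd_fact)
    then show "K div k * k = K" by simp
    then show "K div k > 0" by (metis K_def fact_nonzero gr0I mult_is_0)
  qed
  have K0: "K > 0" by (simp add: K_def)
  have y: "y (K * j) = (\<Sum>k=1..N. cnj (b k) * v (j * k))" for j
    unfolding y_def
  proof (rule sum.cong)
    fix k assume k: "k \<in> {1..N}"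
    have "dilate (K div k) v (K * j) = dilate (K div k) v (K div k * (j * k))"
      using K(3)[OF k] by (metis mult.assoc mult.commute)
    with K(2)[OF k] show "cnj (b k) * dilate (K div k) v (K * j) = cnj (b k) * v (j * k)"
      by simp
  qed simp
  have sy: "square_summable y"
    unfolding y_def using K(2) v by (intro square_summable_combination square_summable_dilate) auto
  have sw: "square_summable (\<lambda>m. \<Sum>k=1..N. b k * dilate k v m)"
    using v by (intro square_summable_combination square_summable_dilate) auto
  have "(\<Sum>j=1..J. (cmod (\<Sum>k=1..N. cnj (b k) * v (j * k)))\<^sup>2) = (\<Sum>m\<in>(*) K ` {1..J}. (cmod (y m))\<^sup>2)"
    using K0 by (subst sum.reindex) (auto simp: y inj_on_def)
  \<comment> \<open>The inequality arises only here, where the values of \<open>y\<close> off the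
    chosen multiples of \<open>K\<close> are added; the next step is an equality of norms.\<close>
  also have "\<dots> \<le> (\<Sum>m. (cmod (y m))\<^sup>2)"
    by (intro sum_le_suminf sy) auto
  also have "\<dots> = (\<Sum>m. (cmod (\<Sum>k=1..N. b k * dilate k v m))\<^sup>2)"
  proof -
    have "(\<lambda>m. of_real ((cmod (y m))\<^sup>2)) sums (\<Sum>k=1..N. \<Sum>l=1..N.
        cnj (b k) * cnj (cnj (b l)) * ell2_inner (dilate (K div k) v) (dilate (K div l) v))"
      unfolding y_def using K(2) v by (intro norm2_combination_sums square_summable_dilate) auto
    also have "(\<Sum>k=1..N. \<Sum>l=1..N.
        cnj (b k) * cnj (cnj (b l)) * ell2_inner (dilate (K div k) v) (dilate (K div l) v))
      = (\<Sum>k=1..N. \<Sum>l=1..N. cnj (b k) * b l * ell2_inner (dilate l v) (dilate k v))"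
    proof (intro sum.cong refl)
      fix k l assume kl: "k \<in> {1..N}" "l \<in> {1..N}"
      have "ell2_inner (dilate (K div k) v) (dilate (K div l) v) = ell2_inner (dilate l v) (dilate k v)"
        using K(2,3)[OF kl(1)] K(2,3)[OF kl(2)] kl v
        by (intro ell2_inner_dilate_ratio) (auto simp: mult.commute)
      then show "cnj (b k) * cnj (cnj (b l)) * ell2_inner (dilate (K div k) v) (dilate (K div l) v)
          = cnj (b k) * b l * ell2_inner (dilate l v) (dilate k v)" by simp
    qed
    \<comment> \<open>Exchanging the names of \<open>k\<close> and \<open>l\<close> turns this into
      the Gram sum of the combination without adjoints.\<close>
    also have "\<dots> = (\<Sum>k=1..N. \<Sum>l=1..N. b k * cnj (b l) * ell2_inner (dilate k v) (dilate l v))"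
      by (subst sum.swap) (simp add: mult_ac)
    finally have 1: "(\<lambda>m. complex_of_real ((cmod (y m))\<^sup>2)) sums \<dots>" .
    have 2: "(\<lambda>m. complex_of_real ((cmod (\<Sum>k=1..N. b k * dilate k v m))\<^sup>2)) sums
        (\<Sum>k=1..N. \<Sum>l=1..N. b k * cnj (b l) * ell2_inner (dilate k v) (dilate l v))"
      using v by (intro norm2_combination_sums square_summable_dilate) auto
    have "complex_of_real (\<Sum>m. (cmod (y m))\<^sup>2)
        = complex_of_real (\<Sum>m. (cmod (\<Sum>k=1..N. b k * dilate k v m))\<^sup>2)"
      using sums_unique2[OF sums_of_real[OF summable_sums[OF sy]] 1]
        sums_unique2[OF sums_of_real[OF summable_sums[OF sw]] 2] by simp
    then show ?thesis by (simp only: of_real_eq_iff)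
  qed
  finally show ?thesis .
qed

section \<open>Littlewood-Paley integration\<close>

text \<open>
  The factor \<open>4 x n\<^sup>-\<^sup>2\<^sup>x\<close> of the Littlewood--Paley formula; its integral \<open>1 / ln\<^sup>2 n\<close> undoes the two
  differentiations.
\<close>

definition weight :: "nat \<Rightarrow> real \<Rightarrow> real" where
  "weight n x = indicator {0..} x * (4 * x * (real n powr (- x))\<^sup>2)"

lemma weight_nonneg: "weight n x \<ge> 0"
  by (auto simp: weight_def indicator_def)

lemma weight_measurable [measurable]: "weight n \<in> borel_measurable borel"
  unfolding weight_def by measurable

lemma nn_integral_weight:
  assumes "n \<ge> 2"
  shows "(\<integral>\<^sup>+x. ennreal (weight n x) \<partial>lborel) = ennreal (1 / (ln (real n))\<^sup>2)"
proof -
  define L where "L = ln (real n)"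
  have L: "L > 0" using assms by (simp add: L_def)
  \<comment> \<open>The antiderivative of 4 x exp(-2 L x) that vanishes at infinity, found by parts;
    \<open>- F 0\<close> is 1 / L^2.\<close>
  define F where "F = (\<lambda>x. - (2 * x / L + 1 / L\<^sup>2) * exp (- (2 * L * x)))"
  have "(\<integral>\<^sup>+x. ennreal (4 * x * exp (- (2 * L * x))) * indicator {0..} x \<partial>lborel) = ennreal (0 - F 0)"
  proof (rule nn_integral_FTC_atLeast)
    show "DERIV F x :> 4 * x * exp (- (2 * L * x))" for x
      unfolding F_def using L
      by (auto intro!: derivative_eq_intros simp: field_simps power2_eq_square)
    have top: "filterlim (\<lambda>x. 2 * L * x) at_top at_top"
      using L by (intro filterlim_tendsto_pos_mult_at_top[OF tendsto_const _ filterlim_ident]) auto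
    have "((\<lambda>x. - (((2 * L * x) ^ 1 / exp (2 * L * x)) + (2 * L * x) ^ 0 / exp (2 * L * x)) / L\<^sup>2)
        \<longlongrightarrow> - (0 + 0) / L\<^sup>2) at_top"
      using L by (intro tendsto_intros filterlim_compose[OF tendsto_power_div_exp_0 top]) auto
    moreover have "(\<lambda>x. - (((2 * L * x) ^ 1 / exp (2 * L * x)) + (2 * L * x) ^ 0 / exp (2 * L * x)) / L\<^sup>2) = F"
      using L by (auto simp: F_def fun_eq_iff exp_minus field_simps power2_eq_square)
    ultimately show "(F \<longlongrightarrow> 0) at_top" by simp
  qed auto
  moreover have "ennreal (4 * x * exp (- (2 * L * x))) * indicator {0..} x = ennreal (weight n x)" for x
  proof -
    have "(real n powr (- x))\<^sup>2 = exp (- (2 * L * x))"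
      using assms by (simp add: powr_def L_def power2_eq_square exp_add[symmetric])
    then show ?thesis by (auto simp: weight_def indicator_def)
  qed
  ultimately show ?thesis by (simp add: F_def L_def)
qed

lemma has_bochner_integral_weight:
  assumes "n \<ge> 2"
  shows "has_bochner_integral lborel (weight n) (1 / (ln (real n))\<^sup>2)"
  using assms by (intro has_bochner_integral_nn_integral nn_integral_weight) (auto simp: weight_nonneg)

text \<open>Up to sign, \<open>A\<close>, \<open>v\<close> and \<open>W\<close> are the coefficients
  of f', g' and h g' translated by \<open>x\<close>, \<open>\<beta>\<close> those of the translate
  of h, and \<open>w\<close> is the adjoint of multiplication by the latter applied to
  \<open>v\<close>. Cauchy-Schwarz is replaced by the arithmetic-geometric mean inequality with
  parameter \<open>t\<close>, whose right side is additive in the coefficients and so can be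
  integrated in \<open>x\<close> term by term.\<close>

lemma volterra_pairing_bound_pointwise:
  fixes a :: "nat \<Rightarrow> complex" and N :: nat
  assumes c: "square_summable c" and e: "square_summable e"
    and e_eq: "\<And>m. of_real (ln (real m)) * e m
      = (\<Sum>k=1..M. b k * dilate k (\<lambda>n. of_real (ln (real n)) * c n) m)"
    and t: "t > 0" and x: "x > 0"
  defines "d \<equiv> \<lambda>m. (t * (if m \<in> {1..N} then (cmod (a m))\<^sup>2 else 0) + (cmod (e m))\<^sup>2 / t) / 2"
  shows "summable (\<lambda>m. (real m powr (- x))\<^sup>2 * (ln (real m))\<^sup>2 * d m)" (is ?S)
    and "cmod (\<Sum>j=1..N. \<Sum>k=1..M. a j * b k * cnj (c (j * k)) *
          of_real (ln (real j) * ln (real (j * k)) * (real (j * k) powr (- x))\<^sup>2))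
      \<le> (\<Sum>m. (real m powr (- x))\<^sup>2 * (ln (real m))\<^sup>2 * d m)" (is ?B)
proof -
  define r where "r = (\<lambda>n. real n powr (- x))"
  have r_fold: "real n powr (- x) = r n" for n by (simp add: r_def)
  have r_mult: "r (j * k) = r j * r k" for j k by (simp add: r_def powr_mult)
  define A where "A = (\<lambda>j. if j \<in> {1..N} then a j * of_real (ln (real j) * r j) else 0)"
  define v where "v = (\<lambda>n. of_real (r n * ln (real n)) * c n)"
  define \<beta> where "\<beta> = (\<lambda>k. b k * of_real (r k))"
  define w where "w = (\<lambda>j. \<Sum>k=1..M. cnj (\<beta> k) * v (j * k))"
  define W where "W = (\<lambda>m. \<Sum>k=1..M. \<beta> k * dilate k v m)"
  \<comment> \<open>Translation by x > 0 absorbs the logarithm of the derivative, so the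
    differentiated sequences stay square summable.\<close>
  have rln: "(r n * ln (real n))\<^sup>2 \<le> (1 / x)\<^sup>2" for n
  proof (cases "n = 0")
    case False
    then have n: "real n \<ge> 1" by simp
    have "ln (real n) \<le> real n powr x / x" using n x by (rule ln_powr_bound)
    then have "r n * ln (real n) \<le> r n * (real n powr x / x)"
      by (intro mult_left_mono) (auto simp: r_def)
    also have "\<dots> = 1 / x" using n by (simp add: r_def powr_minus)
    finally show ?thesis using n by (intro power_mono) (auto simp: r_def)
  qed simp
  have scaled: "square_summable (\<lambda>n. of_real (r n * ln (real n)) * u n)" if "square_summable u" for u
  proof (rule summable_comparison_test)
    show "summable (\<lambda>n. (1 / x)\<^sup>2 * (cmod (u n))\<^sup>2)" using that by (rule summable_mult)
    show "\<exists>N. \<forall>n\<ge>N. norm ((cmod (of_real (r n * ln (real n)) * u n))\<^sup>2) \<le> (1 / x)\<^sup>2 * (cmod (u n))\<^sup>2"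
      using mult_right_mono[OF rln zero_le_power2]
      by (auto simp del: of_real_mult simp: norm_mult power_mult_distrib abs_mult)
  qed
  have v: "square_summable v" unfolding v_def using c by (rule scaled)
  have W: "W m = of_real (r m * ln (real m)) * e m" for m
  proof -
    have "\<beta> k * dilate k v m = of_real (r m) * (b k * dilate k (\<lambda>n. of_real (ln (real n)) * c n) m)" for k
      by (auto simp: \<beta>_def dilate_def v_def r_mult elim!: dvdE)
    then have "W m = of_real (r m) * (of_real (ln (real m)) * e m)"
      unfolding W_def e_eq sum_distrib_left by simp
    then show ?thesis by simp
  qed
  have sW: "square_summable W" unfolding W using e by (rule scaled)
  have sA: "square_summable A"
    by (rule summable_finite[of "{1..N}"]) (auto simp: A_def)
  have summand: "(t * (cmod (A m))\<^sup>2 + (cmod (W m))\<^sup>2 / t) / 2 = (real m powr (- x))\<^sup>2 * (ln (real m))\<^sup>2 * d m" for m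
    unfolding W A_def d_def r_def
    by (auto simp: norm_mult power_mult_distrib field_simps simp flip: of_real_mult)
  have sd: "summable (\<lambda>m. (t * (cmod (A m))\<^sup>2 + (cmod (W m))\<^sup>2 / t) / 2)"
    using sA sW by (intro summable_divide summable_add summable_mult)
  then show ?S unfolding summand .
  have split: "(\<Sum>m. (t * (cmod (A m))\<^sup>2 + (cmod (W m))\<^sup>2 / t) / 2)
      = (t * (\<Sum>m. (cmod (A m))\<^sup>2) + (\<Sum>m. (cmod (W m))\<^sup>2) / t) / 2"
    using sA sW by (simp add: suminf_divide suminf_add[symmetric] suminf_mult summable_mult summable_divide summable_add)
  have "(\<Sum>j=1..N. \<Sum>k=1..M. a j * b k * cnj (c (j * k)) *
          of_real (ln (real j) * ln (real (j * k)) * (real (j * k) powr (- x))\<^sup>2))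
      = (\<Sum>j=1..N. A j * cnj (w j))"
    unfolding w_def cnj_sum sum_distrib_left
    by (intro sum.cong refl)
       (simp add: A_def v_def \<beta>_def r_mult r_fold power2_eq_square mult_ac del: of_nat_mult)
  also have "cmod \<dots> \<le> (\<Sum>j=1..N. cmod (A j * cnj (w j)))" by (rule norm_sum)
  also have "\<dots> \<le> (\<Sum>j=1..N. (t * (cmod (A j))\<^sup>2 + (cmod (w j))\<^sup>2 / t) / 2)"
  proof (rule sum_mono)
    fix j
    have "0 \<le> (t * cmod (A j) - cmod (w j))\<^sup>2 / t" using t by simp
    then show "cmod (A j * cnj (w j)) \<le> (t * (cmod (A j))\<^sup>2 + (cmod (w j))\<^sup>2 / t) / 2"
      using t by (simp add: norm_mult power2_diff field_simps power2_eq_square)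
  qed
  also have "\<dots> = (t * (\<Sum>j=1..N. (cmod (A j))\<^sup>2) + (\<Sum>j=1..N. (cmod (w j))\<^sup>2) / t) / 2"
    by (simp only: sum_divide_distrib[symmetric] sum.distrib sum_distrib_left[symmetric])
  \<comment> \<open>Hyponormality replaces the adjoint \<open>w\<close> by the product
    \<open>W\<close>, which is controlled by \<open>e\<close>.\<close>
  also have "\<dots> \<le> (t * (\<Sum>m. (cmod (A m))\<^sup>2) + (\<Sum>m. (cmod (W m))\<^sup>2) / t) / 2"
    using t norm2_adjoint_le[OF v, of \<beta> M N] sum_le_suminf[OF sA, of "{1..N}"]
    by (intro divide_right_mono add_mono mult_left_mono) (auto simp: w_def W_def)
  finally show ?B unfolding split[symmetric] summand .
qed

text \<open>The best parameter is t = Y / X. Enlarging both numbers by \<open>\<epsilon>\<close>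
  keeps it defined and positive when \<open>X\<close> or \<open>Y\<close> is 0, and then
  \<open>\<epsilon>\<close> tends to 0.\<close>

lemma le_mult_of_le_weighted_mean:
  fixes B X Y :: real
  assumes "\<And>t. t > 0 \<Longrightarrow> B \<le> (t * X\<^sup>2 + Y\<^sup>2 / t) / 2" "X \<ge> 0" "Y \<ge> 0"
  shows "B \<le> X * Y"
proof -
  have "B \<le> (X + \<epsilon>) * (Y + \<epsilon>)" if \<epsilon>: "\<epsilon> > 0" for \<epsilon>
  proof -
    define P Q where "P = X + \<epsilon>" and "Q = Y + \<epsilon>"
    have pos: "P > 0" "Q > 0" using assms \<epsilon> by (auto simp: P_def Q_def)
    define t where "t = Q / P"
    have t: "t > 0" using pos by (simp add: t_def)
    have "B \<le> (t * X\<^sup>2 + Y\<^sup>2 / t) / 2" by (rule assms(1)[OF t])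
    also have "\<dots> \<le> (t * P\<^sup>2 + Q\<^sup>2 / t) / 2"
      using t assms \<epsilon> unfolding P_def Q_def by (intro divide_right_mono add_mono mult_left_mono power_mono) auto
    also have "\<dots> = P * Q"
      using pos by (simp add: t_def power2_eq_square)
    finally show ?thesis unfolding P_def Q_def .
  qed
  then have "\<forall>\<^sub>F \<epsilon> in at_right 0. B \<le> (X + \<epsilon>) * (Y + \<epsilon>)"
    by (auto simp: eventually_at_filter)
  moreover have "((\<lambda>\<epsilon>. (X + \<epsilon>) * (Y + \<epsilon>)) \<longlongrightarrow> (X + 0) * (Y + 0)) (at_right 0)"
    by (intro tendsto_intros)
  ultimately show ?thesis using tendsto_lowerbound by fastforce
qed

text \<open>Integrates the pointwise bound against 4 x. On the left the weight contributes 1 / ln^2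
  (j k), leaving the quotient of logarithms; on the right it cancels ln^2 m. The parameter
  \<open>t\<close> is optimised only after the integration.\<close>

lemma volterra_pairing_bound:
  assumes c: "square_summable c" and e: "square_summable e"
    and e_eq: "\<And>m. of_real (ln (real m)) * e m
      = (\<Sum>k=1..M. b k * dilate k (\<lambda>n. of_real (ln (real n)) * c n) m)"
  shows "cmod (\<Sum>j=1..N. \<Sum>k=1..M. a j * b k * cnj (c (j * k)) *
          of_real (ln (real j) / ln (real (j * k))))
      \<le> sqrt (\<Sum>j=1..N. (cmod (a j))\<^sup>2) * sqrt (\<Sum>m. (cmod (e m))\<^sup>2)"
    (is "cmod ?B \<le> sqrt ?X * sqrt ?Y")
proof (rule le_mult_of_le_weighted_mean)
  have Y0: "?Y \<ge> 0" using e by (intro suminf_nonneg) auto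
  have X0: "?X \<ge> 0" by (intro sum_nonneg) auto
  show "sqrt ?X \<ge> 0" "sqrt ?Y \<ge> 0" using X0 Y0 by auto
  fix t :: real assume t: "t > 0"
  define d where "d = (\<lambda>m. (t * (if m \<in> {1..N} then (cmod (a m))\<^sup>2 else 0) + (cmod (e m))\<^sup>2 / t) / 2)"
  have d0: "d m \<ge> 0" for m using t by (auto simp: d_def)
  have dsums: "d sums ((t * ?X + ?Y / t) / 2)"
    unfolding d_def using e
    by (intro sums_divide sums_add sums_mult sums_If_finite_set summable_sums) auto
  define q where "q = (\<lambda>j k. a j * b k * cnj (c (j * k)) * of_real (ln (real j) * ln (real (j * k))))"
  define \<Phi> where "\<Phi> = (\<lambda>x. \<Sum>j=1..N. \<Sum>k=1..M. q j k * of_real (weight (j * k) x))"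
  have "has_bochner_integral lborel \<Phi>
     (\<Sum>j=1..N. \<Sum>k=1..M. a j * b k * cnj (c (j * k)) * of_real (ln (real j) / ln (real (j * k))))"
    unfolding \<Phi>_def
  proof (intro has_bochner_integral_sum)
    fix j k assume jk: "j \<in> {1..N}" "k \<in> {1..M}"
    show "has_bochner_integral lborel (\<lambda>x. q j k * of_real (weight (j * k) x))
        (a j * b k * cnj (c (j * k)) * of_real (ln (real j) / ln (real (j * k))))"
    proof (cases "j * k = 1")
      \<comment> \<open>For j = k = 1 both sides are 0: \<open>q j k\<close> contains
        \<open>ln 1\<close>, and the quotient of logarithms is 0 / 0 = 0.\<close>
      case True
      then show ?thesis by (auto simp: q_def intro: has_bochner_integral_zero)
    next
      case False
      moreover have "j * k \<noteq> 0" using jk by simp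
      ultimately have n: "j * k \<ge> 2" by linarith
      have "has_bochner_integral lborel (\<lambda>x. q j k * of_real (weight (j * k) x))
          (q j k * of_real (1 / (ln (real (j * k)))\<^sup>2))"
        using has_bochner_integral_weight[OF n]
        by (intro has_bochner_integral_mult_right has_bochner_integral_of_real)
      also have "q j k * of_real (1 / (ln (real (j * k)))\<^sup>2)
          = a j * b k * cnj (c (j * k)) * of_real (ln (real j) / ln (real (j * k)))"
        by (simp add: q_def power2_eq_square flip: of_real_mult of_real_divide)
      finally show ?thesis .
    qed
  qed
  then have "ennreal (cmod ?B) \<le> (\<integral>\<^sup>+x. ennreal (cmod (\<Phi> x)) \<partial>lborel)"
    by (rule has_bochner_integral_norm_bound)
  also have "\<dots> \<le> (\<integral>\<^sup>+x. (\<Sum>m. ennreal ((ln (real m))\<^sup>2 * d m) * ennreal (weight m x)) \<partial>lborel)"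
  proof (rule nn_integral_mono)
    fix x :: real
    show "ennreal (cmod (\<Phi> x)) \<le> (\<Sum>m. ennreal ((ln (real m))\<^sup>2 * d m) * ennreal (weight m x))"
    proof (cases "x > 0")
      case False
      then have "\<Phi> x = 0" by (auto simp: \<Phi>_def weight_def indicator_def)
      then show ?thesis by simp
    next
      case True
      have pw: "summable (\<lambda>m. (real m powr (- x))\<^sup>2 * (ln (real m))\<^sup>2 * d m)"
        "cmod (\<Sum>j=1..N. \<Sum>k=1..M. a j * b k * cnj (c (j * k)) *
            of_real (ln (real j) * ln (real (j * k)) * (real (j * k) powr (- x))\<^sup>2))
          \<le> (\<Sum>m. (real m powr (- x))\<^sup>2 * (ln (real m))\<^sup>2 * d m)"
        unfolding d_def by (rule volterra_pairing_bound_pointwise[OF c e e_eq t True])+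
      have sm: "summable (\<lambda>m. (ln (real m))\<^sup>2 * d m * weight m x)"
        using summable_mult[OF pw(1), of "4 * x"] True by (simp add: weight_def mult_ac)
      have "\<Phi> x = of_real (4 * x) * (\<Sum>j=1..N. \<Sum>k=1..M. a j * b k * cnj (c (j * k)) *
          of_real (ln (real j) * ln (real (j * k)) * (real (j * k) powr (- x))\<^sup>2))"
        unfolding \<Phi>_def q_def weight_def sum_distrib_left using True
        by (intro sum.cong refl) (simp add: mult_ac)
      then have "cmod (\<Phi> x) \<le> 4 * x * (\<Sum>m. (real m powr (- x))\<^sup>2 * (ln (real m))\<^sup>2 * d m)"
        using True pw(2) by (simp add: norm_mult del: of_real_mult of_nat_mult)
      also have "\<dots> = (\<Sum>m. (ln (real m))\<^sup>2 * d m * weight m x)"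
        using True by (subst suminf_mult[OF pw(1), symmetric]) (simp add: weight_def mult_ac)
      finally have "ennreal (cmod (\<Phi> x)) \<le> ennreal (\<Sum>m. (ln (real m))\<^sup>2 * d m * weight m x)"
        by (rule ennreal_leI)
      also have "\<dots> = (\<Sum>m. ennreal ((ln (real m))\<^sup>2 * d m * weight m x))"
        using sm d0 by (intro suminf_ennreal2[symmetric]) (auto simp: weight_nonneg)
      also have "\<dots> = (\<Sum>m. ennreal ((ln (real m))\<^sup>2 * d m) * ennreal (weight m x))"
        using d0 by (simp add: ennreal_mult weight_nonneg)
      finally show ?thesis .
    qed
  qed
  also have "\<dots> = (\<Sum>m. ennreal ((ln (real m))\<^sup>2 * d m) * (\<integral>\<^sup>+x. ennreal (weight m x) \<partial>lborel))"
    by (subst nn_integral_suminf) (auto simp: nn_integral_cmult)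
  also have "\<dots> \<le> (\<Sum>m. ennreal (d m))"
  proof (intro suminf_le allI)
    fix m
    show "ennreal ((ln (real m))\<^sup>2 * d m) * (\<integral>\<^sup>+x. ennreal (weight m x) \<partial>lborel) \<le> ennreal (d m)"
    proof (cases "m \<ge> 2")
      \<comment> \<open>Here \<open>ln (real m) = 0\<close>, also for \<open>m = 0\<close> by
        convention, so the left side is 0.\<close>
      case False
      then have "m = 0 \<or> m = 1" by auto
      then show ?thesis by auto
    next
      case True
      then have "ennreal ((ln (real m))\<^sup>2 * d m) * ennreal (1 / (ln (real m))\<^sup>2) = ennreal (d m)"
        using d0 by (subst ennreal_mult[symmetric]) auto
      with nn_integral_weight[OF True] show ?thesis by simp
    qed
  qed auto
  also have "\<dots> = ennreal ((t * ?X + ?Y / t) / 2)"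
    using dsums d0 by (intro suminf_ennreal_eq) auto
  finally have "cmod ?B \<le> (t * ?X + ?Y / t) / 2"
    using t X0 Y0 by (subst (asm) ennreal_le_iff) auto
  then show "cmod ?B \<le> (t * (sqrt ?X)\<^sup>2 + (sqrt ?Y)\<^sup>2 / t) / 2"
    using X0 Y0 by simp
qed

section \<open>From coefficients to the Hankel form\<close>

text \<open>Multiplying by the logarithm puts the coefficient formula in the form that
  \<open>volterra_pairing_bound\<close> takes as its assumption \<open>e_eq\<close>.\<close>

lemma dirichlet_coeff_volterra:
  assumes f: "\<And>s. f s = (\<Sum>k=1..N. b k * of_nat k powr (- s))"
    and g: "has_dirichlet_series g c"
  shows "of_real (ln (real m)) * dirichlet_coeff (volterra g f) m
      = (\<Sum>k=1..N. b k * dilate k (\<lambda>n. of_real (ln (real n)) * c n) m)"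
proof -
  note coeff = dirichlet_coeff_eqI[OF has_dirichlet_series_volterra[OF f g]]
  show ?thesis
  proof (cases "m = 0 \<or> m = 1")
    case True
    then have "(\<Sum>k=1..N. b k * dilate k (\<lambda>n. of_real (ln (real n)) * c n) m) = 0"
      by (intro sum.neutral) (auto simp: dilate_def)
    with True show ?thesis by (auto simp: coeff)
  next
    case False
    then have "ln (real m) \<noteq> 0" by auto
    then show ?thesis by (simp add: coeff)
  qed
qed

lemma hardy2_polynomial:
  assumes f: "\<And>s. f s = (\<Sum>k=1..N. b k * of_nat k powr (- s))"
  shows "f \<in> hardy2" "hardy2_norm f = sqrt (\<Sum>k=1..N. (cmod (b k))\<^sup>2)"
proof -
  note series = has_dirichlet_series_polynomial[OF f]
  have "(\<lambda>m. (cmod (if m \<in> {1..N} then b m else 0))\<^sup>2) sums (\<Sum>k=1..N. (cmod (b k))\<^sup>2)"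
    using sums_If_finite_set[of "{1..N}" "\<lambda>m. (cmod (b m))\<^sup>2"]
    by (simp add: if_distrib[of cmod] if_distrib[of "\<lambda>x. x\<^sup>2"] cong: if_cong)
  with series show "f \<in> hardy2" "hardy2_norm f = sqrt (\<Sum>k=1..N. (cmod (b k))\<^sup>2)"
    by (auto simp: hardy2_def hardy2_norm_def dirichlet_class_def dirichlet_coeff_eqI[OF series] sums_iff)
qed

text \<open>Pairing a sequence dilated by \<open>j\<close> with \<open>c\<close> samples
  \<open>c\<close> along the multiples of \<open>j\<close>, which yields the multiplicative Hankel
  matrix with entries \<open>cnj (c (j * k))\<close>.\<close>

lemma hankel_form_polynomial:
  assumes f: "\<And>s. f s = (\<Sum>k=1..N. a k * of_nat k powr (- s))"
    and h: "\<And>s. h s = (\<Sum>k=1..M. b k * of_nat k powr (- s))"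
    and g: "has_dirichlet_series g c"
  shows "hankel_form g (\<lambda>s. f s * h s) = (\<Sum>j=1..N. \<Sum>k=1..M. a j * b k * cnj (c (j * k)))"
proof -
  define b' where "b' = (\<lambda>m. if m \<in> {1..M} then b m else 0)"
  have "(\<lambda>m. a j * (dilate j b' m * cnj (c m))) sums (a j * (\<Sum>k=1..M. b k * cnj (c (j * k))))"
    if "j \<in> {1..N}" for j
  proof (rule sums_mult, rule dilate_sums[where k = j])
    show "(\<lambda>k. b' k * cnj (c (j * k))) sums (\<Sum>k=1..M. b k * cnj (c (j * k)))"
      using sums_If_finite_set[of "{1..M}" "\<lambda>k. b k * cnj (c (j * k))"]
      by (simp add: b'_def if_distrib[of "\<lambda>x. x * _"] cong: if_cong)
  qed (use that in \<open>auto simp: dilate_def\<close>)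
  then have "(\<lambda>m. \<Sum>j=1..N. a j * (dilate j b' m * cnj (c m)))
      sums (\<Sum>j=1..N. a j * (\<Sum>k=1..M. b k * cnj (c (j * k))))"
    by (rule sums_sum)
  moreover have "dirichlet_coeff (\<lambda>s. f s * h s) = (\<lambda>m. \<Sum>j=1..N. a j * dilate j b' m)"
    unfolding b'_def
    by (intro dirichlet_coeff_eqI has_dirichlet_series_mult_polynomial
          has_dirichlet_series_polynomial f h)
  ultimately show ?thesis
    unfolding hankel_form_def hardy2_inner_def dirichlet_coeff_eqI[OF g]
    by (simp add: sums_iff sum_distrib_left sum_distrib_right mult_ac)
qed

theorem corollary6p2:
  fixes g :: "complex \<Rightarrow> complex"
  assumes "g \<in> dirichlet_class"
    and "volterra_bounded g"
  shows "hankel_bounded g"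
proof -
  from assms(1) obtain c where g: "has_dirichlet_series g c"
    unfolding dirichlet_class_def by blast
  from assms(2) obtain C where C:
    "\<And>f. f \<in> hardy2 \<Longrightarrow> volterra g f \<in> hardy2"
    "\<And>f. f \<in> hardy2 \<Longrightarrow> hardy2_norm (volterra g f) \<le> C * hardy2_norm f"
    unfolding volterra_bounded_def by blast
  \<comment> \<open>Test the operator on the constant 1: its image is \<open>g\<close> without the
    constant term, so the coefficients agree from index 2 on.\<close>
  have c: "square_summable c"
  proof -
    have one: "\<And>s. (\<lambda>s. 1) s = (\<Sum>k=1..1::nat. (\<lambda>k. 1) k * of_nat k powr (- s :: complex))"
      by simp
    have "square_summable (dirichlet_coeff (volterra g (\<lambda>s. 1)))"
      using C(1)[OF hardy2_polynomial(1)[OF one]] by (simp add: hardy2_def)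
    moreover have "\<forall>\<^sub>F m in sequentially. (cmod (dirichlet_coeff (volterra g (\<lambda>s. 1)) m))\<^sup>2 = (cmod (c m))\<^sup>2"
      using eventually_ge_at_top[of 2]
    proof eventually_elim
      case (elim m)
      then show ?case using dirichlet_coeff_volterra[OF one g, of m] by (simp add: dilate_def)
    qed
    ultimately show ?thesis by (rule summable_cong[THEN iffD1, rotated])
  qed
  have bound: "cmod (\<Sum>j=1..N. \<Sum>k=1..M. a j * b k * cnj (c (j * k)) *
          of_real (ln (real j) / ln (real (j * k)))) \<le> hardy2_norm f * (C * hardy2_norm h)"
    if f: "\<And>s. f s = (\<Sum>k=1..N. a k * of_nat k powr (- s))"
      and h: "\<And>s. h s = (\<Sum>k=1..M. b k * of_nat k powr (- s))" for f h a b N M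
  proof -
    have "h \<in> hardy2" by (rule hardy2_polynomial(1)[OF h])
    from C(1,2)[OF this] have "square_summable (dirichlet_coeff (volterra g h))"
      and le: "sqrt (\<Sum>m. (cmod (dirichlet_coeff (volterra g h) m))\<^sup>2) \<le> C * hardy2_norm h"
      by (auto simp: hardy2_def hardy2_norm_def)
    note volterra_pairing_bound[OF c this(1) dirichlet_coeff_volterra[OF h g], of a N]
    also have "sqrt (\<Sum>j=1..N. (cmod (a j))\<^sup>2) = hardy2_norm f"
      using hardy2_polynomial(2)[OF f] by simp
    also have "hardy2_norm f * sqrt (\<Sum>m. (cmod (dirichlet_coeff (volterra g h) m))\<^sup>2)
        \<le> hardy2_norm f * (C * hardy2_norm h)"
      using le unfolding hardy2_polynomial(2)[OF f] by (intro mult_left_mono) (auto simp: sum_nonneg)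
    finally show ?thesis .
  qed
  show ?thesis
    unfolding hankel_bounded_def
  \<comment> \<open>The summand \<open>cmod (c 1)\<close> pays for the constant term of f h, and
    each of the two pairings costs \<open>C\<close>.\<close>
  proof (intro exI[of _ "cmod (c 1) + 2 * C"] allI impI)
    fix f h assume "dirichlet_polynomial f" "dirichlet_polynomial h"
    then obtain N a M b where
      f: "\<And>s. f s = (\<Sum>k=1..N. a k * of_nat k powr (- s))" and
      h: "\<And>s. h s = (\<Sum>k=1..M. b k * of_nat k powr (- s))"
      unfolding dirichlet_polynomial_def by blast
    define B1 where "B1 = (\<Sum>j=1..N. \<Sum>k=1..M. a j * b k * cnj (c (j * k)) *
          of_real (ln (real j) / ln (real (j * k))))"
    \<comment> \<open>Summed with \<open>k\<close> outside, so that \<open>bound\<close> applies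
      with \<open>f\<close> and \<open>h\<close> exchanged.\<close>
    define B2 where "B2 = (\<Sum>k=1..M. \<Sum>j=1..N. b k * a j * cnj (c (k * j)) *
          of_real (ln (real k) / ln (real (k * j))))"
    define B0 where "B0 = (\<Sum>j=1..N. \<Sum>k=1..M. if j = 1 then if k = 1 then a 1 * b 1 * cnj (c 1) else 0 else 0)"
    have coeff: "cmod (a 1) \<le> sqrt (\<Sum>k=1..N. (cmod (a k))\<^sup>2)" if "N \<ge> 1" for a :: "nat \<Rightarrow> complex" and N
    proof (rule real_le_rsqrt)
      show "(cmod (a 1))\<^sup>2 \<le> (\<Sum>k=1..N. (cmod (a k))\<^sup>2)"
        using that member_le_sum[of 1 "{1..N}" "\<lambda>k. (cmod (a k))\<^sup>2"] by auto
    qed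
    \<comment> \<open>The product rule on coefficients: ln j + ln k = ln (j k), so the two quotients
      add up to 1 unless j = k = 1. There both are 0 / 0 = 0, and the separate first summand
      supplies the term.\<close>
    have split: "a j * b k * cnj (c (j * k))
        = (if j = 1 then if k = 1 then a 1 * b 1 * cnj (c 1) else 0 else 0)
        + a j * b k * cnj (c (j * k)) * of_real (ln (real j) / ln (real (j * k)))
        + b k * a j * cnj (c (k * j)) * of_real (ln (real k) / ln (real (k * j)))"
      if "j \<in> {1..N}" "k \<in> {1..M}" for j k
    proof (cases "j = 1 \<and> k = 1")
      case False
      have "j * k \<noteq> 0" "j * k \<noteq> 1" using that False by auto
      then have "ln (real (j * k)) \<noteq> 0" by (metis ln_eq_zero_iff of_nat_0_less_iff of_nat_eq_1_iff neq0_conv)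
      moreover have "ln (real j) + ln (real k) = ln (real (j * k))" using that by (simp add: ln_mult)
      ultimately have "ln (real j) / ln (real (j * k)) + ln (real k) / ln (real (j * k)) = 1"
        by (simp add: add_divide_distrib[symmetric])
      then have one: "complex_of_real (ln (real j) / ln (real (j * k)))
          + of_real (ln (real k) / ln (real (j * k))) = 1"
        by (metis of_real_1 of_real_add)
      have "(if j = 1 then if k = 1 then a 1 * b 1 * cnj (c 1) else 0 else 0) = 0"
        using False by auto
      then show ?thesis
        unfolding mult.commute[of k j] mult.commute[of "b k" "a j"]
        by (simp only: add_0_left distrib_left[symmetric] one mult_1_right)
    qed auto
    have "hankel_form g (\<lambda>s. f s * h s) = (\<Sum>j=1..N. \<Sum>k=1..M. a j * b k * cnj (c (j * k)))"
      by (rule hankel_form_polynomial[OF f h g])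
    also have "\<dots> = (\<Sum>j=1..N. \<Sum>k=1..M. (if j = 1 then if k = 1 then a 1 * b 1 * cnj (c 1) else 0 else 0)
        + a j * b k * cnj (c (j * k)) * of_real (ln (real j) / ln (real (j * k)))
        + b k * a j * cnj (c (k * j)) * of_real (ln (real k) / ln (real (k * j))))"
      by (intro sum.cong refl split)
    also have "\<dots> = B0 + B1 + B2"
      unfolding sum.distrib B0_def B1_def B2_def by (subst (4) sum.swap) (rule refl)
    finally have eq: "hankel_form g (\<lambda>s. f s * h s) = B0 + B1 + B2" .
    have "cmod B1 \<le> hardy2_norm f * (C * hardy2_norm h)"
      unfolding B1_def by (rule bound[OF f h])
    moreover have "cmod B2 \<le> hardy2_norm h * (C * hardy2_norm f)"
      unfolding B2_def by (rule bound[OF h f])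
    moreover have "cmod B0 \<le> hardy2_norm f * hardy2_norm h * cmod (c 1)"
    \<comment> \<open>If either polynomial is an empty sum, index 1 is out of range and
      \<open>B0\<close> vanishes.\<close>
    proof (cases "N \<ge> 1 \<and> M \<ge> 1")
      case True
      have "B0 = (\<Sum>j=1..N. if j = 1 then (\<Sum>k=1..M. if k = 1 then a 1 * b 1 * cnj (c 1) else 0) else 0)"
        unfolding B0_def by (intro sum.cong) auto
      then have "B0 = a 1 * b 1 * cnj (c 1)" using True by simp
      then show ?thesis
        unfolding hardy2_polynomial(2)[OF f] hardy2_polynomial(2)[OF h]
        using True coeff[of N a] coeff[of M b]
        by (auto simp: norm_mult sum_nonneg intro!: mult_mono)
    next
      case False
      then have "B0 = 0" by (auto simp: B0_def not_le)
      then show ?thesis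
        unfolding hardy2_polynomial(2)[OF f] hardy2_polynomial(2)[OF h] by (simp add: sum_nonneg)
    qed
    ultimately show "cmod (hankel_form g (\<lambda>s. f s * h s)) \<le> (cmod (c 1) + 2 * C) * hardy2_norm f * hardy2_norm h"
      using norm_triangle_ineq[of "B0 + B1" B2] norm_triangle_ineq[of B0 B1]
      unfolding eq by (simp add: algebra_simps)
  qed
qed

end
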